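(* Let $s$ be a positive integer and let $\lambda=(\lambda_1,\lambda_2,\dots,\lambda_{\ell})$ be a strict partition. Then $\lambda\lambda$ is a doubled distinct $s$-core partition if and only if both of the following hold: (a) $\lambda$ is an $\overline{s}$-core. (b) If $s$ is even, then $s/2$ is not a part of $\lambda$.
   Context: A strict partition $\lambda=(\lambda_1>\lambda_2>\cdots>\lambda_\ell)$ is a finite strictly decreasing sequence of positive integers. The bar lengths in the $i$th row of $\lambda$ are the elements of $\{\lambda_i+\lambda_{i+1},\dots,\lambda_i+\lambda_\ell\}\cup\big(\{1,2,\dots,\lambda_i\}\setminus\{\lambda_i-\lambda_{i+1},\dots,\lambda_i-\lambda_\ell\}\big)$. $\lambda$ is an $\overline{s}$-core if $s$ is not a bar length in any row of $\lambda$. The doubled distinct partition $\lambda\lambda$ of $\lambda$ is the ordinary partition with Frobenius symbol $\begin{pmatrix}\lambda_1&\cdots&\lambda_\ell\\ \lambda_1-1&\cdots&\lambda_\ell-1\end{pmatrix}$ (the $i$th diagonal box has arm length $\lambda_i$ and leg length $\lambda_i-1$). It is a doubled distinct $s$-core if no hook length of its Young diagram is divisible by $s$. *)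

theory Defs
  imports Main
begin

text \<open>Partitions are lists of positive parts. Rows, columns and list positions are
  counted from 0, so box (i, j) lies in row i + 1 and column j + 1 of the usual drawing.\<close>

definition is_partition :: "nat list \<Rightarrow> bool" where
  "is_partition mu \<longleftrightarrow> sorted_wrt (\<ge>) mu \<and> (\<forall>x\<in>set mu. 0 < x)"

definition strict_partition :: "nat list \<Rightarrow> bool" where
  "strict_partition lam \<longleftrightarrow> sorted_wrt (>) lam \<and> (\<forall>x\<in>set lam. 0 < x)"

text \<open>Every subtraction below is a genuine one when lam is strict.\<close>

definition bar_lengths :: "nat list \<Rightarrow> nat \<Rightarrow> nat set" where
  "bar_lengths lam i =
     {lam ! i + lam ! j | j. i < j \<and> j < length lam} \<union>
     ({1..lam ! i} - {lam ! i - lam ! j | j. i < j \<and> j < length lam})"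

definition bar_core :: "nat \<Rightarrow> nat list \<Rightarrow> bool" where
  "bar_core s lam \<longleftrightarrow> (\<forall>i<length lam. s \<notin> bar_lengths lam i)"

definition young_diagram :: "nat list \<Rightarrow> (nat \<times> nat) set" where
  "young_diagram mu = {(i, j). i < length mu \<and> j < mu ! i}"

definition arm_length :: "nat list \<Rightarrow> nat \<Rightarrow> nat \<Rightarrow> nat" where
  "arm_length mu i j = card {j'. j < j' \<and> (i, j') \<in> young_diagram mu}"

definition leg_length :: "nat list \<Rightarrow> nat \<Rightarrow> nat \<Rightarrow> nat" where
  "leg_length mu i j = card {i'. i < i' \<and> (i', j) \<in> young_diagram mu}"

definition hook_length :: "nat list \<Rightarrow> nat \<Rightarrow> nat \<Rightarrow> nat" where
  "hook_length mu i j = arm_length mu i j + leg_length mu i j + 1"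

definition is_core :: "nat \<Rightarrow> nat list \<Rightarrow> bool" where
  "is_core s mu \<longleftrightarrow> (\<forall>(i, j)\<in>young_diagram mu. \<not> s dvd hook_length mu i j)"

definition durfee :: "nat list \<Rightarrow> nat" where
  "durfee mu = card {i. (i, i) \<in> young_diagram mu}"

text \<open>The diagonal boxes of the diagram of a partition are those with i < durfee mu.\<close>

definition frobenius_symbol :: "nat list \<Rightarrow> nat list \<times> nat list" where
  "frobenius_symbol mu =
     (map (\<lambda>i. arm_length mu i i) [0..<durfee mu],
      map (\<lambda>i. leg_length mu i i) [0..<durfee mu])"

text \<open>The description is proper for strict lam: see \<open>doubled_distinct_ex1\<close> below.\<close>

definition doubled_distinct :: "nat list \<Rightarrow> nat list" where
  "doubled_distinct lam =
     (THE mu. is_partition mu \<and> frobenius_symbol mu = (lam, map (\<lambda>x. x - 1) lam))"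

lemma young_diagram_down:
  assumes "is_partition mu" "(i, j) \<in> young_diagram mu" "i' \<le> i" "j' \<le> j"
  shows "(i', j') \<in> young_diagram mu"
proof -
  have "mu ! i \<le> mu ! i'"
    using assms unfolding is_partition_def young_diagram_def
    by (cases "i' = i") (auto simp: sorted_wrt_iff_nth_less)
  then show ?thesis
    using assms by (auto simp: young_diagram_def)
qed

lemma finite_young_diagram: "finite (young_diagram mu)"
proof -
  have "young_diagram mu = Sigma {..<length mu} (\<lambda>i. {..<mu ! i})"
    by (auto simp: young_diagram_def)
  then show ?thesis by simp
qed

lemma down_closed_nat:
  fixes S :: "nat set"
  assumes "finite S" "\<And>x y. x \<in> S \<Longrightarrow> y \<le> x \<Longrightarrow> y \<in> S"
  shows "S = {..<card S}"
proof (cases "S = {}")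
  case False
  have "S = {..Max S}"
    using assms False by (auto intro: Max_ge Max_in)
  then show ?thesis
    by (metis card_atMost lessThan_Suc_atMost)
qed simp

lemma diagonal_iff:
  assumes "is_partition mu"
  shows "(i, i) \<in> young_diagram mu \<longleftrightarrow> i < durfee mu"
proof -
  have "finite {i. (i, i) \<in> young_diagram mu}"
    by (rule finite_subset[OF _ finite_imageI[OF finite_young_diagram[of mu], of fst]]) force
  then have "{i. (i, i) \<in> young_diagram mu} = {..<durfee mu}"
    unfolding durfee_def
    by (rule down_closed_nat) (auto intro: young_diagram_down[OF assms])
  then show ?thesis by blast
qed

lemma arm_iff:
  assumes "is_partition mu" "(i, k) \<in> young_diagram mu"
  shows "(i, j) \<in> young_diagram mu \<longleftrightarrow> j \<le> k + arm_length mu i k"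
proof -
  have "{j'. k < j' \<and> (i, j') \<in> young_diagram mu} = {k<..<mu ! i}"
    using assms by (auto simp: young_diagram_def)
  then have "arm_length mu i k = mu ! i - Suc k"
    by (simp add: arm_length_def)
  then show ?thesis
    using assms by (auto simp: young_diagram_def)
qed

lemma leg_iff:
  assumes "is_partition mu" "(k, j) \<in> young_diagram mu"
  shows "(i, j) \<in> young_diagram mu \<longleftrightarrow> i \<le> k + leg_length mu k j"
proof -
  let ?S = "{i. (i, j) \<in> young_diagram mu}"
  have "finite ?S"
    by (rule finite_subset[OF _ finite_imageI[OF finite_young_diagram[of mu], of fst]]) force
  then have "?S = {..<card ?S}"
    by (rule down_closed_nat) (auto intro: young_diagram_down[OF assms(1)])
  then obtain c where "?S = {..<c}" ..
  then have *: "(i, j) \<in> young_diagram mu \<longleftrightarrow> i < c" for i by blast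
  have "{i'. k < i' \<and> (i', j) \<in> young_diagram mu} = {k<..<c}"
    unfolding * by auto
  then have "leg_length mu k j = c - Suc k"
    by (simp add: leg_length_def)
  then show ?thesis
    using assms(2) unfolding * by simp arith
qed

lemma young_diagram_frobenius:
  assumes "is_partition mu" "frobenius_symbol mu = (a, b)"
  shows "(i, j) \<in> young_diagram mu \<longleftrightarrow>
    i < length a \<and> j \<le> i + a ! i \<or> j < length a \<and> i \<le> j + b ! j"
proof -
  have len: "length a = durfee mu"
    and a: "\<And>i. i < durfee mu \<Longrightarrow> a ! i = arm_length mu i i"
    and b: "\<And>i. i < durfee mu \<Longrightarrow> b ! i = leg_length mu i i"
    using assms(2) by (auto simp: frobenius_symbol_def)
  have r: "(i, j) \<in> young_diagram mu \<longleftrightarrow> j \<le> i + a ! i" if "i < durfee mu"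
    using that arm_iff[OF assms(1)] a diagonal_iff[OF assms(1)] by simp
  have c: "(i, j) \<in> young_diagram mu \<longleftrightarrow> i \<le> j + b ! j" if "j < durfee mu"
    using that leg_iff[OF assms(1)] b diagonal_iff[OF assms(1)] by simp
  have "(i, j) \<notin> young_diagram mu" if "\<not> i < durfee mu" "\<not> j < durfee mu"
    using that young_diagram_down[OF assms(1), of i j "durfee mu" "durfee mu"]
      diagonal_iff[OF assms(1)] by auto
  then show ?thesis
    using r c len by auto
qed

lemma young_diagram_inj:
  assumes "is_partition mu" "is_partition nu" "young_diagram mu = young_diagram nu"
  shows "mu = nu"
proof -
  have rows: "length ka = card {i. (i, 0) \<in> young_diagram ka}" if "is_partition ka" for ka
  proof -
    have "{i. (i, 0) \<in> young_diagram ka} = {..<length ka}"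
      using that by (auto simp: young_diagram_def is_partition_def)
    then show ?thesis by simp
  qed
  have cols: "ka ! i = card {j. (i, j) \<in> young_diagram ka}" if "i < length ka" for ka i
  proof -
    have "{j. (i, j) \<in> young_diagram ka} = {..<ka ! i}"
      using that by (auto simp: young_diagram_def)
    then show ?thesis by simp
  qed
  have len: "length mu = length nu"
    unfolding rows[OF assms(1)] rows[OF assms(2)] assms(3) ..
  have "mu ! i = nu ! i" if "i < length mu" for i
    unfolding cols[OF that] cols[OF that[unfolded len]] assms(3) ..
  with len show ?thesis by (rule nth_equalityI)
qed

lemma doubled_distinct_ex1:
  assumes "strict_partition lam"
  shows "\<exists>!mu. is_partition mu \<and> frobenius_symbol mu = (lam, map (\<lambda>x. x - 1) lam)"
proof (rule ex_ex1I)
  define l where "l = length lam"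
  define N where "N = (if lam = [] then 0 else hd lam)"
  define row where "row i = (if i < l then i + 1 + lam ! i else card {j. j < l \<and> i < j + lam ! j})" for i
  define mu where "mu = map row [0..<N]"
  have pos: "0 < lam ! i" if "i < l" for i
    using assms that by (simp add: strict_partition_def l_def)
  have dec: "lam ! j < lam ! i" if "i < j" "j < l" for i j
    using assms that by (simp add: strict_partition_def l_def sorted_wrt_iff_nth_less)
  have shift: "j + lam ! j \<le> i + lam ! i" if "i \<le> j" "j < l" for i j
    using that
  proof (induction j rule: dec_induct)
    case (step n)
    then show ?case using dec[of n "Suc n"] by force
  qed simp
  have N: "j + lam ! j \<le> N" if "j < l" for j
    using shift[of 0 j] that by (cases lam) (auto simp: N_def l_def)
  have lN: "l \<le> N"
  proof (cases l)
    case (Suc k)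
    then show ?thesis using N[of k] pos[of k] by simp
  qed simp
  have row2: "j < row i \<longleftrightarrow> j < l \<and> i < j + lam ! j" if "\<not> i < l" for i j
  proof -
    have "{j. j < l \<and> i < j + lam ! j} = {..<card {j. j < l \<and> i < j + lam ! j}}"
      by (rule down_closed_nat) (auto intro: less_le_trans[OF _ shift])
    then show ?thesis using that unfolding row_def by auto
  qed
  have D: "(i, j) \<in> young_diagram mu \<longleftrightarrow>
     (if i < l then j \<le> i + lam ! i else j < l \<and> i < j + lam ! j)" for i j
  proof (cases "i < l")
    case True
    then show ?thesis using lN by (auto simp: young_diagram_def mu_def row_def)
  next
    case False
    then show ?thesis using row2[OF False, of j] N[of j]
      by (auto simp: young_diagram_def mu_def)
  qed
  have mono: "row j \<le> row i" if ij: "i < j" for i j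
  proof -
    have "k < row i" if k: "k < row j" for k
    proof (cases "i < l")
      case True
      show ?thesis
      proof (cases "j < l")
        case True
        then show ?thesis using k ij shift[of i j] by (simp add: row_def)
      next
        case False
        then have "k < l" using k row2 by blast
        then have "k \<le> i + lam ! i"
          using shift[of i k] by (cases "i \<le> k") auto
        then show ?thesis using \<open>i < l\<close> by (simp add: row_def)
      qed
    next
      case False
      then show ?thesis
        using k ij row2[of j k] row2[of i k] by auto
    qed
    then show ?thesis by (metis not_le less_irrefl)
  qed
  have "0 < row i" if "i < N" for i
    using that row2[of i 0] by (cases lam) (auto simp: row_def N_def l_def)
  then have part: "is_partition mu"
    using mono by (auto simp: is_partition_def mu_def sorted_wrt_iff_nth_less)
  have "{i. (i, i) \<in> young_diagram mu} = {..<l}"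
    using D by auto
  then have d: "durfee mu = l" by (simp add: durfee_def)
  have arm: "arm_length mu i i = lam ! i" if "i < l" for i
  proof -
    have "{j'. i < j' \<and> (i, j') \<in> young_diagram mu} = {i<..i + lam ! i}"
      using that D by auto
    then show ?thesis by (simp add: arm_length_def)
  qed
  have leg: "leg_length mu i i = lam ! i - 1" if "i < l" for i
  proof -
    have "i < i' \<and> (i', i) \<in> young_diagram mu \<longleftrightarrow> i < i' \<and> i' < i + lam ! i" for i'
    proof (cases "i' < l")
      case True
      then show ?thesis
        using that D[of i' i] shift[of i i'] pos[of i'] by auto
    next
      case False
      then show ?thesis using that D[of i' i] by auto
    qed
    then have "{i'. i < i' \<and> (i', i) \<in> young_diagram mu} = {i<..<i + lam ! i}"
      unfolding set_eq_iff greaterThanLessThan_iff mem_Collect_eq by blast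
    then show ?thesis by (simp add: leg_length_def)
  qed
  have "frobenius_symbol mu = (lam, map (\<lambda>x. x - 1) lam)"
    using arm leg by (auto simp: frobenius_symbol_def d l_def intro!: nth_equalityI)
  with part show "\<exists>mu. is_partition mu \<and> frobenius_symbol mu = (lam, map (\<lambda>x. x - 1) lam)"
    by blast
next
  fix mu nu
  assume mu: "is_partition mu \<and> frobenius_symbol mu = (lam, map (\<lambda>x. x - 1) lam)"
    and nu: "is_partition nu \<and> frobenius_symbol nu = (lam, map (\<lambda>x. x - 1) lam)"
  have "young_diagram mu = young_diagram nu"
    using young_diagram_frobenius[of mu] young_diagram_frobenius[of nu] mu nu
    by (simp add: set_eq_iff split_paired_all)
  then show "mu = nu" using mu nu young_diagram_inj by blast
qed

lemma doubled_distinct: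
  assumes "strict_partition lam"
  shows "is_partition (doubled_distinct lam)"
    and "frobenius_symbol (doubled_distinct lam) = (lam, map (\<lambda>x. x - 1) lam)"
proof -
  have "is_partition (doubled_distinct lam) \<and>
      frobenius_symbol (doubled_distinct lam) = (lam, map (\<lambda>x. x - 1) lam)"
    unfolding doubled_distinct_def by (rule theI') (rule doubled_distinct_ex1[OF assms])
  then show "is_partition (doubled_distinct lam)"
    and "frobenius_symbol (doubled_distinct lam) = (lam, map (\<lambda>x. x - 1) lam)"
    by (rule conjunct1, rule conjunct2)
qed

end

theory Submission
  imports Defs
begin

text \<open>
  The boundary path of a partition, read as a two-sided infinite word in vertical and
  horizontal steps, places every row at an integer (a bead) and every column at an integer
  (a gap), and each integer is used exactly once. A row and a column meet in a box exactly if
  the bead lies to the right of the gap, and the hook length of that box is the distance from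
  the gap to the bead (\<open>hook_length_eq_bead_minus_gap\<close>). Hence a partition is an
  s-core if and only if its set of beads is closed under subtraction of s
  (\<open>is_core_iff_beads_closed\<close>); multiples of s then follow by iteration.

  The Frobenius symbol is the description of the bead set relative to the set of negative
  integers: arms are the nonnegative beads, and legs mark the negative gaps. For the symbol of
  a doubled distinct partition this means that 0 is a gap, a positive n is a bead exactly if n
  is a part, and -n is a bead exactly if n is not a part. Shifting a bead x down by s therefore
  obstructs the s-core property in three ways: x = s is a part; x > s is a part while x - s is
  not; or x < s and s - x are both parts. A negative bead leads to the second case again, read
  backwards. The first two cases, together with the third for distinct x and s - x, say that s
  is a bar length (\<open>bar_core_iff\<close>). What remains is x = s - x, that is, s/2 being
  a part.
\<close>

section \<open>Beads and gaps of a partition\<close>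

definition row_len :: "nat list \<Rightarrow> nat \<Rightarrow> nat" where
  "row_len mu i = (if i < length mu then mu ! i else 0)"

definition col_len :: "nat list \<Rightarrow> nat \<Rightarrow> nat" where
  "col_len mu j = card {i. (i, j) \<in> young_diagram mu}"

text \<open>The offsets place the corner of the empty partition between -1 and 0: its rows lie at
  -1, -2, ... and its columns at 0, 1, .... Rows and columns of length zero count as well.\<close>

definition row_bead :: "nat list \<Rightarrow> nat \<Rightarrow> int" where
  "row_bead mu i = int (row_len mu i) - int i - 1"

definition col_gap :: "nat list \<Rightarrow> nat \<Rightarrow> int" where
  "col_gap mu j = int j - int (col_len mu j)"

definition beads :: "nat list \<Rightarrow> int set" where
  "beads mu = range (row_bead mu)"

lemma mem_diagram_iff_row_len: "(i, j) \<in> young_diagram mu \<longleftrightarrow> j < row_len mu i"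
  by (auto simp: young_diagram_def row_len_def)

lemma mem_diagram_iff_col_len:
  assumes "is_partition mu"
  shows "(i, j) \<in> young_diagram mu \<longleftrightarrow> i < col_len mu j"
proof -
  have "finite {i. (i, j) \<in> young_diagram mu}"
    by (rule finite_subset[OF _ finite_imageI[OF finite_young_diagram[of mu], of fst]]) force
  then have "{i. (i, j) \<in> young_diagram mu} = {..<col_len mu j}"
    unfolding col_len_def
    by (rule down_closed_nat) (auto intro: young_diagram_down[OF assms])
  then show ?thesis by blast
qed

lemma arm_length_eq: "arm_length mu i j = row_len mu i - Suc j"
proof -
  have "{j'. j < j' \<and> (i, j') \<in> young_diagram mu} = {j<..<row_len mu i}"
    by (auto simp: mem_diagram_iff_row_len)
  then show ?thesis by (simp add: arm_length_def)
qed

lemma leg_length_eq: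
  assumes "is_partition mu"
  shows "leg_length mu i j = col_len mu j - Suc i"
proof -
  have "{i'. i < i' \<and> (i', j) \<in> young_diagram mu} = {i<..<col_len mu j}"
    by (auto simp: mem_diagram_iff_col_len[OF assms])
  then show ?thesis by (simp add: leg_length_def)
qed

text \<open>For a box, row i is longer than j and column j longer than i; otherwise neither holds.
  Since both comparisons always go the same way, so does that of their sums.\<close>

lemma mem_diagram_iff_gap_less_bead:
  assumes "is_partition mu"
  shows "(i, j) \<in> young_diagram mu \<longleftrightarrow> col_gap mu j < row_bead mu i"
  using mem_diagram_iff_row_len[of i j mu] mem_diagram_iff_col_len[OF assms, of i j]
  unfolding col_gap_def row_bead_def by linarith

lemma hook_length_eq_bead_minus_gap:
  assumes "is_partition mu" "(i, j) \<in> young_diagram mu"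
  shows "int (hook_length mu i j) = row_bead mu i - col_gap mu j"
proof -
  have "j < row_len mu i" "i < col_len mu j"
    using assms mem_diagram_iff_row_len mem_diagram_iff_col_len by auto
  then show ?thesis
    by (simp add: hook_length_def arm_length_eq leg_length_eq[OF assms(1)] row_bead_def col_gap_def)
qed

lemma col_gap_neq_row_bead:
  assumes "is_partition mu"
  shows "col_gap mu j \<noteq> row_bead mu i"
  using mem_diagram_iff_row_len[of i j mu] mem_diagram_iff_col_len[OF assms, of i j]
  unfolding col_gap_def row_bead_def by linarith

text \<open>The beads decrease from row to row without bound. Let i be the first row whose bead is
  below n. If n is not a bead, then exactly the rows before i have their beads to the right
  of n, so a column with its gap at n must have length i. This forces its index to be n + i.\<close>

lemma not_bead_is_gap:
  assumes "is_partition mu" "n \<notin> beads mu"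
  obtains j where "n = col_gap mu j"
proof -
  define i where "i = (LEAST i. row_bead mu i < n)"
  have "row_bead mu (length mu + nat (- n)) < n"
    by (simp add: row_bead_def row_len_def)
  then have below: "row_bead mu i < n"
    unfolding i_def by (rule LeastI)
  have above: "n < row_bead mu k" if "k < i" for k
  proof -
    have "\<not> row_bead mu k < n"
      using that unfolding i_def by (rule not_less_Least)
    moreover have "row_bead mu k \<noteq> n"
      using assms(2) by (auto simp: beads_def)
    ultimately show ?thesis by simp
  qed
  define j where "j = nat (n + int i)"
  have j: "int j = n + int i"
    using below unfolding j_def row_bead_def by simp
  have "(i, j) \<notin> young_diagram mu"
    using below j unfolding mem_diagram_iff_row_len row_bead_def by simp
  then have "col_len mu j \<le> i"
    using mem_diagram_iff_col_len[OF assms(1)] by simp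
  moreover have "i \<le> col_len mu j"
  proof (cases i)
    case (Suc k)
    then have "(k, j) \<in> young_diagram mu"
      using above[of k] j unfolding mem_diagram_iff_row_len row_bead_def by simp
    then show ?thesis
      using Suc mem_diagram_iff_col_len[OF assms(1)] by simp
  qed simp
  ultimately have "n = col_gap mu j"
    using j by (simp add: col_gap_def)
  then show ?thesis by (rule that)
qed

lemma mem_beads_iff_no_gap:
  assumes "is_partition mu"
  shows "n \<in> beads mu \<longleftrightarrow> n \<notin> range (col_gap mu)"
proof
  assume "n \<in> beads mu"
  then obtain i where n: "n = row_bead mu i"
    by (auto simp: beads_def)
  show "n \<notin> range (col_gap mu)"
    unfolding n using col_gap_neq_row_bead[OF assms, of _ i] by (metis rangeE)
next
  assume "n \<notin> range (col_gap mu)"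
  then show "n \<in> beads mu"
    using not_bead_is_gap[OF assms, of n] by blast
qed

section \<open>Cores and shifts of the bead set\<close>

text \<open>A bead x with a gap at x - s gives a box of hook length exactly s. If there is no such
  bead, all of x, x - s, x - 2s, ... are beads, so no gap lies at a distance divisible by s to
  the left of a bead.\<close>

lemma is_core_iff_beads_closed:
  assumes "is_partition mu" "0 < s"
  shows "is_core s mu \<longleftrightarrow> (\<forall>x\<in>beads mu. x - int s \<in> beads mu)"
proof
  assume core: "is_core s mu"
  show "\<forall>x\<in>beads mu. x - int s \<in> beads mu"
  proof (rule ballI, rule ccontr)
    fix x assume "x \<in> beads mu" "x - int s \<notin> beads mu"
    then obtain i j where ij: "x = row_bead mu i" "x - int s = col_gap mu j"
      using not_bead_is_gap[OF assms(1)] by (metis beads_def rangeE)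
    then have box: "(i, j) \<in> young_diagram mu"
      using assms mem_diagram_iff_gap_less_bead[OF assms(1), of i j] by linarith
    then have "hook_length mu i j = s"
      using hook_length_eq_bead_minus_gap[OF assms(1) box] ij by linarith
    then show False
      using core box by (auto simp: is_core_def)
  qed
next
  assume closed: "\<forall>x\<in>beads mu. x - int s \<in> beads mu"
  have iter: "x - int (k * s) \<in> beads mu" if "x \<in> beads mu" for x k
  proof (induction k)
    case (Suc k)
    then have "x - int (k * s) - int s \<in> beads mu" using closed by blast
    then show ?case by (simp add: algebra_simps)
  qed (use that in simp)
  have "\<not> s dvd hook_length mu i j" if box: "(i, j) \<in> young_diagram mu" for i j
  proof
    assume "s dvd hook_length mu i j"
    then obtain k where "hook_length mu i j = k * s"
      by (metis dvdE mult.commute)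
    then have "col_gap mu j = row_bead mu i - int (k * s)"
      using hook_length_eq_bead_minus_gap[OF assms(1) box] by linarith
    then have "col_gap mu j \<in> beads mu"
      using iter[of "row_bead mu i" k] by (simp add: beads_def)
    then show False
      using mem_beads_iff_no_gap[OF assms(1)] by blast
  qed
  then show "is_core s mu" by (auto simp: is_core_def)
qed

section \<open>Beads of a Frobenius symbol\<close>

text \<open>Rows that meet the diagonal are those with nonnegative beads, and their beads are the
  arms of the diagonal boxes. Columns that meet the diagonal are those with negative gaps, and
  their gaps are given by the legs.\<close>

lemma beads_frobenius:
  assumes "is_partition mu" "frobenius_symbol mu = (a, b)"
  shows "int n \<in> beads mu \<longleftrightarrow> n \<in> set a"
    and "- 1 - int n \<in> beads mu \<longleftrightarrow> n \<notin> set b"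
proof -
  have a: "set a = (\<lambda>i. arm_length mu i i) ` {..<durfee mu}"
    and b: "set b = (\<lambda>i. leg_length mu i i) ` {..<durfee mu}"
    using assms(2) by (auto simp: frobenius_symbol_def)
  have row: "row_bead mu i = int n \<longleftrightarrow> i < durfee mu \<and> arm_length mu i i = n" for i
    using diagonal_iff[OF assms(1), of i] mem_diagram_iff_row_len[of i i mu]
    unfolding arm_length_eq row_bead_def by linarith
  have col: "col_gap mu j = - 1 - int n \<longleftrightarrow> j < durfee mu \<and> leg_length mu j j = n" for j
    using diagonal_iff[OF assms(1), of j] mem_diagram_iff_col_len[OF assms(1), of j j]
    unfolding leg_length_eq[OF assms(1)] col_gap_def by linarith
  have "int n \<in> beads mu \<longleftrightarrow> (\<exists>i. row_bead mu i = int n)"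
    unfolding beads_def by (metis rangeE rangeI)
  then show "int n \<in> beads mu \<longleftrightarrow> n \<in> set a"
    unfolding row a by auto
  have "- 1 - int n \<in> beads mu \<longleftrightarrow> \<not> (\<exists>j. col_gap mu j = - 1 - int n)"
    unfolding mem_beads_iff_no_gap[OF assms(1)] by (metis rangeE rangeI)
  then show "- 1 - int n \<in> beads mu \<longleftrightarrow> n \<notin> set b"
    unfolding col b by auto
qed

text \<open>The leg paired with a part p is p - 1, so its gap is at -1 - (p - 1) = -p.\<close>

lemma beads_doubled_distinct:
  assumes "strict_partition lam"
  shows "int n \<in> beads (doubled_distinct lam) \<longleftrightarrow> n \<in> set lam"
    and "0 < n \<Longrightarrow> - int n \<in> beads (doubled_distinct lam) \<longleftrightarrow> n \<notin> set lam"
proof -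
  note beads = beads_frobenius[OF doubled_distinct[OF assms]]
  show "int n \<in> beads (doubled_distinct lam) \<longleftrightarrow> n \<in> set lam"
    by (rule beads(1))
  assume "0 < n"
  then obtain m where m: "n = Suc m" by (cases n) auto
  have "\<forall>x\<in>set lam. 0 < x"
    using assms by (simp add: strict_partition_def)
  then have "m \<in> set (map (\<lambda>x. x - 1) lam) \<longleftrightarrow> n \<in> set lam"
    unfolding m by (force simp: image_iff)
  moreover have "- int n = - 1 - int m"
    using m by simp
  ultimately show "- int n \<in> beads (doubled_distinct lam) \<longleftrightarrow> n \<notin> set lam"
    using beads(2)[of m] by simp
qed

section \<open>Bar lengths and the comparison\<close>

text \<open>The parts smaller than \<open>lam ! i\<close> are exactly the later ones, which turns the
  conditions on positions into conditions on the set of parts.\<close>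

lemma bar_core_iff:
  assumes "0 < s" "strict_partition lam"
  shows "bar_core s lam \<longleftrightarrow>
    s \<notin> set lam \<and>
    (\<forall>p\<in>set lam. s < p \<longrightarrow> p - s \<in> set lam) \<and>
    (\<forall>p\<in>set lam. \<forall>q\<in>set lam. q < p \<longrightarrow> p + q \<noteq> s)"
proof -
  have dec: "lam ! j < lam ! i \<longleftrightarrow> i < j" if "i < length lam" "j < length lam" for i j
    using assms(2) that
    by (metis linorder_neqE_nat not_less_iff_gr_or_eq sorted_wrt_iff_nth_less strict_partition_def)
  have later: "(\<exists>j. i < j \<and> j < length lam \<and> P (lam ! j)) \<longleftrightarrow> (\<exists>q\<in>set lam. q < lam ! i \<and> P q)"
    if "i < length lam" for i P
    using dec[OF that] by (metis in_set_conv_nth)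
  have pos: "0 < p" if "p \<in> set lam" for p
    using assms(2) that by (simp add: strict_partition_def)
  have row: "s \<in> bar_lengths lam i \<longleftrightarrow>
      (\<exists>q\<in>set lam. q < lam ! i \<and> s = lam ! i + q) \<or>
      s \<le> lam ! i \<and> \<not> (\<exists>q\<in>set lam. q < lam ! i \<and> s = lam ! i - q)"
    if "i < length lam" for i
    unfolding later[OF that, symmetric] using assms(1) by (auto simp: bar_lengths_def)
  have diff: "(\<exists>q\<in>set lam. q < p \<and> s = p - q) \<longleftrightarrow> s < p \<and> p - s \<in> set lam" for p
  proof
    assume "\<exists>q\<in>set lam. q < p \<and> s = p - q"
    then obtain q where "q \<in> set lam" "q < p" "s = p - q" by blast
    moreover from this have "p - s = q" "0 < q" using pos by auto
    ultimately show "s < p \<and> p - s \<in> set lam" by auto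
  next
    assume "s < p \<and> p - s \<in> set lam"
    then show "\<exists>q\<in>set lam. q < p \<and> s = p - q"
      using assms(1) by (intro bexI[of _ "p - s"]) auto
  qed
  have "bar_core s lam \<longleftrightarrow> (\<forall>p\<in>set lam.
      \<not> (\<exists>q\<in>set lam. q < p \<and> s = p + q) \<and> \<not> (s \<le> p \<and> \<not> (s < p \<and> p - s \<in> set lam)))"
    unfolding bar_core_def using row by (simp add: diff all_set_conv_all_nth)
  then show ?thesis by (auto simp: le_less)
qed

theorem proposition2p3:
  fixes s :: nat and lam :: "nat list"
  assumes "0 < s"
    and "strict_partition lam"
  shows "is_core s (doubled_distinct lam) \<longleftrightarrow>
    bar_core s lam \<and> (even s \<longrightarrow> s div 2 \<notin> set lam)"
proof -
  let ?B = "beads (doubled_distinct lam)"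
  note bead = beads_doubled_distinct[OF assms(2)]
  \<comment> \<open>Since 0 is not a part, there is no bead at 0, which excludes the part s.\<close>
  have zero: "0 \<notin> set lam"
    using assms(2) by (auto simp: strict_partition_def)
  have "is_core s (doubled_distinct lam) \<longleftrightarrow> (\<forall>x\<in>?B. x - int s \<in> ?B)"
    by (rule is_core_iff_beads_closed[OF doubled_distinct(1)[OF assms(2)] assms(1)])
  also have "\<dots> \<longleftrightarrow> s \<notin> set lam \<and>
      (\<forall>p\<in>set lam. s < p \<longrightarrow> p - s \<in> set lam) \<and>
      (\<forall>p\<in>set lam. p < s \<longrightarrow> s - p \<notin> set lam)" (is "_ \<longleftrightarrow> ?C")
  proof
    assume closed: "\<forall>x\<in>?B. x - int s \<in> ?B"
    have shift: "int p - int s \<in> ?B" if "p \<in> set lam" for p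
      using closed that bead(1) by blast
    have "s \<notin> set lam"
      using shift[of s] bead(1)[of 0] zero by auto
    moreover have "p - s \<in> set lam" if "p \<in> set lam" "s < p" for p
      using shift[OF that(1)] that(2) bead(1)[of "p - s"] by (simp add: of_nat_diff)
    moreover have "s - p \<notin> set lam" if "p \<in> set lam" "p < s" for p
      using shift[OF that(1)] that(2) bead(2)[of "s - p"] by (simp add: of_nat_diff)
    ultimately show ?C by blast
  next
    assume C: ?C
    show "\<forall>x\<in>?B. x - int s \<in> ?B"
    proof
      fix x assume x: "x \<in> ?B"
      show "x - int s \<in> ?B"
      proof (cases "0 \<le> x")
        case True
        then obtain p where p: "x = int p" by (metis nonneg_int_cases)
        then have mem: "p \<in> set lam" using x bead(1) by simp
        then consider "s < p" | "p < s" using C by (metis linorder_neqE_nat)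
        then show ?thesis
        proof cases
          case 1
          then have "int (p - s) \<in> ?B" using C mem bead(1) by blast
          then show ?thesis using 1 p by (simp add: of_nat_diff)
        next
          case 2
          then have "- int (s - p) \<in> ?B" using C mem bead(2)[of "s - p"] by simp
          then show ?thesis using 2 p by (simp add: of_nat_diff)
        qed
      next
        case False
        then obtain p where p: "x = - int p" "0 < p"
          by (metis neg_int_cases not_le)
        then have "p \<notin> set lam" using x bead(2) by simp
        \<comment> \<open>If p + s were a part, its difference p with s would be one, too.\<close>
        then have "p + s \<notin> set lam" using C p(2) by fastforce
        then have "- int (p + s) \<in> ?B" using p(2) bead(2)[of "p + s"] by simp
        then show ?thesis using p(1) by simp
      qed
    qed
  qed
  also have "\<dots> \<longleftrightarrow> bar_core s lam \<and> (even s \<longrightarrow> s div 2 \<notin> set lam)"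
  proof -
    have "(\<forall>p\<in>set lam. p < s \<longrightarrow> s - p \<notin> set lam) \<longleftrightarrow>
        (\<forall>p\<in>set lam. \<forall>q\<in>set lam. p + q \<noteq> s)"
    proof
      assume L: "\<forall>p\<in>set lam. p < s \<longrightarrow> s - p \<notin> set lam"
      show "\<forall>p\<in>set lam. \<forall>q\<in>set lam. p + q \<noteq> s"
      proof (intro ballI notI)
        fix p q assume pq: "p \<in> set lam" "q \<in> set lam" "p + q = s"
        moreover from this have "q \<noteq> 0" "s - p = q" using zero by (metis, simp)
        ultimately show False using L by force
      qed
    qed force
    also have "\<dots> \<longleftrightarrow> (\<forall>p\<in>set lam. \<forall>q\<in>set lam. q < p \<longrightarrow> p + q \<noteq> s) \<and>
        (\<forall>p\<in>set lam. p + p \<noteq> s)"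
      by (metis add.commute linorder_neqE_nat)
    also have "(\<forall>p\<in>set lam. p + p \<noteq> s) \<longleftrightarrow> (even s \<longrightarrow> s div 2 \<notin> set lam)"
      by (auto simp: mult_2 elim!: evenE)
    finally show ?thesis
      unfolding bar_core_iff[OF assms] by blast
  qed
  finally show ?thesis .
qed

end
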